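(* Let $\kappa$ be a field and let $\mathscr M$ be a matricube with ground set $Q_\varrho=\prod_{j=1}^m\{0,1,\dots,\varrho_j\}$, where $m\ge1$ and $\varrho_1,\dots,\varrho_m$ are non-negative integers. If $\mathscr M$ is representable over $\kappa$, then for every $a\in Q_\varrho$ the local matroid $\mathrm M_a$ of $\mathscr M$ at $a$ is representable over $\kappa$.
   Context: $Q_\varrho$ is ordered coordinatewise: $x\preceq y$ iff $x_j\le y_j$ for all $j$. The operations $\vee$ and $\wedge$ are the coordinatewise maximum and minimum. $e_i$ is the $i$-th unit vector. A matricube with ground set $Q_\varrho$ is given by a function $\mathbf r:Q_\varrho\to\mathbb Z$ (its rank function) such that: (R1) $\mathbf r(0)=0$ and $\mathbf r(t\,e_i)-\mathbf r((t-1)e_i)\le 1$ for all $1\le i\le m$ and $1\le t\le \varrho_i$; (R2) $x\preceq y$ implies $\mathbf r(x)\le\mathbf r(y)$; (R3) $\mathbf r(x)+\mathbf r(y)\ge \mathbf r(x\vee y)+\mathbf r(x\wedge y)$ for all $x,y\in Q_\varrho$. An initial (decreasing) flag of length $s$ in a finite-dimensional $\kappa$-vector space $H$ is a chain of subspaces $H=F^0\supseteq F^1\supseteq\dots\supseteq F^s\supsetneq(0)$ with each $F^i$ of codimension $0$ or $1$ in $F^{i-1}$. $\mathscr M$ is representable over $\kappa$ if there are a finite-dimensional $\kappa$-vector space $H$ and initial flags $F_1^\bullet,\dots,F_m^\bullet$ in $H$ of lengths $\varrho_1,\dots,\varrho_m$ such that $\mathbf r(x)=\mathrm{codim}_\kappa\bigl(F_1^{x_1}\cap\dots\cap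 F_m^{x_m}\bigr)$ for all $x\in Q_\varrho$. For $a\in Q_\varrho$, let $I_a=\{i: a+e_i\in Q_\varrho\}$. The local matroid $\mathrm M_a$ is the matroid on $I_a$ with rank function $\mathbf r_a(X)=\mathbf r\bigl(a+\sum_{i\in X}e_i\bigr)-\mathbf r(a)$, $X\subseteq I_a$. *)

theory Defs
  imports Complex_Main "HOL-Library.Function_Algebras"
begin

section \<open>Matricubes\<close>

text \<open>
  Vectors of \<open>\<nat>\<^sup>m\<close> are functions \<^typ>\<open>nat \<Rightarrow> nat\<close> vanishing outside \<open>{1..m}\<close>.  Sums, the order,
  \<open>\<or>\<close> and \<open>\<and>\<close> are then the pointwise \<open>+\<close>, \<open>\<le>\<close>, \<^const>\<open>sup\<close> and \<^const>\<open>inf\<close> of the function type.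
\<close>

definition hypercuboid :: "nat \<Rightarrow> (nat \<Rightarrow> nat) \<Rightarrow> (nat \<Rightarrow> nat) set" where
  "hypercuboid m \<rho> = {x. (\<forall>j\<in>{1..m}. x j \<le> \<rho> j) \<and> (\<forall>j. j \<notin> {1..m} \<longrightarrow> x j = 0)}"

definition unit_vec :: "nat \<Rightarrow> nat \<Rightarrow> nat" where
  "unit_vec i = (\<lambda>j. if j = i then 1 else 0)"

definition matricube :: "nat \<Rightarrow> (nat \<Rightarrow> nat) \<Rightarrow> ((nat \<Rightarrow> nat) \<Rightarrow> int) \<Rightarrow> bool" where
  "matricube m \<rho> r \<longleftrightarrow>
     r 0 = 0 \<and>
     (\<forall>i\<in>{1..m}. \<forall>t\<in>{1..\<rho> i}. r (\<lambda>j. t * unit_vec i j) - r (\<lambda>j. (t - 1) * unit_vec i j) \<le> 1) \<and>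
     (\<forall>x\<in>hypercuboid m \<rho>. \<forall>y\<in>hypercuboid m \<rho>. x \<le> y \<longrightarrow> r x \<le> r y) \<and>
     (\<forall>x\<in>hypercuboid m \<rho>. \<forall>y\<in>hypercuboid m \<rho>. r x + r y \<ge> r (sup x y) + r (inf x y))"


section \<open>Matroids and the local matroids of a matricube\<close>

text \<open>Only the values of the rank function on subsets of the ground set \<open>E\<close> are relevant.\<close>

definition matroid :: "'e set \<Rightarrow> ('e set \<Rightarrow> int) \<Rightarrow> bool" where
  "matroid E rk \<longleftrightarrow>
     finite E \<and>
     (\<forall>X. X \<subseteq> E \<longrightarrow> 0 \<le> rk X \<and> rk X \<le> int (card X)) \<and>
     (\<forall>X Y. X \<subseteq> Y \<and> Y \<subseteq> E \<longrightarrow> rk X \<le> rk Y) \<and>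
     (\<forall>X Y. X \<subseteq> E \<and> Y \<subseteq> E \<longrightarrow> rk (X \<union> Y) + rk (X \<inter> Y) \<le> rk X + rk Y)"

definition local_ground :: "nat \<Rightarrow> (nat \<Rightarrow> nat) \<Rightarrow> (nat \<Rightarrow> nat) \<Rightarrow> nat set" where
  "local_ground m \<rho> a = {i \<in> {1..m}. a + unit_vec i \<in> hypercuboid m \<rho>}"

definition local_rank :: "((nat \<Rightarrow> nat) \<Rightarrow> int) \<Rightarrow> (nat \<Rightarrow> nat) \<Rightarrow> nat set \<Rightarrow> int" where
  "local_rank r a X = r (a + (\<Sum>i\<in>X. unit_vec i)) - r a"


section \<open>Representations in a given vector space\<close>

text \<open>
  In this section \<open>scale\<close> is the scalar multiplication of a vector space over the field \<open>'k\<close>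
  (locale \<^locale>\<open>vector_space\<close>).
\<close>

definition fin_dim_subspace :: "('k::field \<Rightarrow> 'v::ab_group_add \<Rightarrow> 'v) \<Rightarrow> 'v set \<Rightarrow> bool" where
  "fin_dim_subspace scale H \<longleftrightarrow>
     module.subspace scale H \<and> (\<exists>B. finite B \<and> module.span scale B = H)"

text \<open>Codimension of a subspace \<open>W\<close> of a finite-dimensional space \<open>H\<close>.\<close>

definition codim :: "('k::field \<Rightarrow> 'v::ab_group_add \<Rightarrow> 'v) \<Rightarrow> 'v set \<Rightarrow> 'v set \<Rightarrow> int" where
  "codim scale H W = int (vector_space.dim scale H) - int (vector_space.dim scale W)"

definition initial_flag ::
    "('k::field \<Rightarrow> 'v::ab_group_add \<Rightarrow> 'v) \<Rightarrow> 'v set \<Rightarrow> nat \<Rightarrow> (nat \<Rightarrow> 'v set) \<Rightarrow> bool" where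
  "initial_flag scale H s F \<longleftrightarrow>
     F 0 = H \<and>
     (\<forall>i\<le>s. module.subspace scale (F i)) \<and>
     (\<forall>i\<in>{1..s}. F i \<subseteq> F (i - 1) \<and> codim scale (F (i - 1)) (F i) \<in> {0, 1}) \<and>
     {0} \<subset> F s"

definition matricube_representation ::
    "('k::field \<Rightarrow> 'v::ab_group_add \<Rightarrow> 'v) \<Rightarrow> 'v set \<Rightarrow> (nat \<Rightarrow> nat \<Rightarrow> 'v set) \<Rightarrow>
     nat \<Rightarrow> (nat \<Rightarrow> nat) \<Rightarrow> ((nat \<Rightarrow> nat) \<Rightarrow> int) \<Rightarrow> bool" where
  "matricube_representation scale H F m \<rho> r \<longleftrightarrow>
     fin_dim_subspace scale H \<and>
     (\<forall>j\<in>{1..m}. initial_flag scale H (\<rho> j) (F j)) \<and>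
     (\<forall>x\<in>hypercuboid m \<rho>. r x = codim scale H (\<Inter>j\<in>{1..m}. F j (x j)))"

definition matroid_representation ::
    "('k::field \<Rightarrow> 'v::ab_group_add \<Rightarrow> 'v) \<Rightarrow> 'v set \<Rightarrow> ('e \<Rightarrow> 'v) \<Rightarrow>
     'e set \<Rightarrow> ('e set \<Rightarrow> int) \<Rightarrow> bool" where
  "matroid_representation scale V v E rk \<longleftrightarrow>
     fin_dim_subspace scale V \<and>
     v ` E \<subseteq> V \<and>
     (\<forall>X. X \<subseteq> E \<longrightarrow> rk X = int (vector_space.dim scale (module.span scale (v ` X))))"


section \<open>Representability over a field\<close>

text \<open>
  HOL cannot quantify existentially over types, so the finite-dimensional vector spaces over
  the field \<open>'k\<close> are taken among the subspaces of the fixed space of all sequences in \<open>'k\<close>.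
  Up to isomorphism these are all of them, and the lemmas \<open>matricube_representableI\<close> and
  \<open>matroid_representableI\<close> below show that a representation in any \<open>'k\<close>-vector space
  is enough.
\<close>

definition seq_scale :: "'k::field \<Rightarrow> (nat \<Rightarrow> 'k) \<Rightarrow> (nat \<Rightarrow> 'k)" where
  "seq_scale c v = (\<lambda>n. c * v n)"

lemma vector_space_seq_scale: "vector_space seq_scale"
  by standard (auto simp: seq_scale_def fun_eq_iff algebra_simps)

definition matricube_representable ::
    "'k::field itself \<Rightarrow> nat \<Rightarrow> (nat \<Rightarrow> nat) \<Rightarrow> ((nat \<Rightarrow> nat) \<Rightarrow> int) \<Rightarrow> bool" where
  "matricube_representable (_ :: 'k itself) m \<rho> r \<longleftrightarrow>
     (\<exists>H F. matricube_representation (seq_scale :: 'k \<Rightarrow> _) H F m \<rho> r)"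

definition matroid_representable ::
    "'k::field itself \<Rightarrow> 'e set \<Rightarrow> ('e set \<Rightarrow> int) \<Rightarrow> bool" where
  "matroid_representable (_ :: 'k itself) E rk \<longleftrightarrow>
     (\<exists>V v. matroid_representation (seq_scale :: 'k \<Rightarrow> _) V v E rk)"


section \<open>Adequacy of the definitions\<close>

lemma local_rank_vec:
  assumes "a \<in> hypercuboid m \<rho>" "X \<subseteq> local_ground m \<rho> a"
  shows "a + (\<Sum>i\<in>X. unit_vec i) = (\<lambda>j. if j \<in> X then a j + 1 else a j)"
    and "a + (\<Sum>i\<in>X. unit_vec i) \<in> hypercuboid m \<rho>"
proof -
  have fin: "finite X"
    by (rule finite_subset[of X "{1..m}"]) (use assms(2) in \<open>auto simp: local_ground_def\<close>)
  have s: "(\<Sum>i\<in>X. unit_vec i) j = (if j \<in> X then 1 else 0)" for j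
    using fin by (induction X rule: finite_induct) (auto simp: unit_vec_def)
  show eq: "a + (\<Sum>i\<in>X. unit_vec i) = (\<lambda>j. if j \<in> X then a j + 1 else a j)"
    by (auto simp: fun_eq_iff s)
  have "a j + 1 \<le> \<rho> j \<and> j \<in> {1..m}" if "j \<in> X" for j
  proof -
    have "j \<in> {1..m}" "a + unit_vec j \<in> hypercuboid m \<rho>"
      using that assms(2) by (auto simp: local_ground_def)
    then have "(a + unit_vec j) j \<le> \<rho> j"
      unfolding hypercuboid_def by blast
    with \<open>j \<in> {1..m}\<close> show ?thesis by (simp add: unit_vec_def)
  qed
  then show "a + (\<Sum>i\<in>X. unit_vec i) \<in> hypercuboid m \<rho>"
    using assms(1) unfolding eq hypercuboid_def by auto
qed

lemma matroid_local:
  assumes mc: "matricube m \<rho> r" and a: "a \<in> hypercuboid m \<rho>"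
  shows "matroid (local_ground m \<rho> a) (local_rank r a)"
proof -
  let ?E = "local_ground m \<rho> a"
  let ?p = "\<lambda>X j. if j \<in> X then a j + 1 else a j"
  have mono: "r x \<le> r y" if "x \<in> hypercuboid m \<rho>" "y \<in> hypercuboid m \<rho>" "x \<le> y" for x y
    using mc that by (auto simp: matricube_def)
  have subm: "r (sup x y) + r (inf x y) \<le> r x + r y"
    if "x \<in> hypercuboid m \<rho>" "y \<in> hypercuboid m \<rho>" for x y
    using mc that by (auto simp: matricube_def)
  have rk: "local_rank r a X = r (?p X) - r a" and pin: "?p X \<in> hypercuboid m \<rho>"
    if "X \<subseteq> ?E" for X
    using local_rank_vec[OF a that] by (simp_all add: local_rank_def)
  have finE: "finite ?E" by (simp add: local_ground_def)
  have monol: "local_rank r a X \<le> local_rank r a Y" if "X \<subseteq> Y" "Y \<subseteq> ?E" for X Y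
  proof -
    have X: "X \<subseteq> ?E" using that by (rule subset_trans)
    have "?p X \<le> ?p Y" using that(1) by (auto simp: le_fun_def)
    then have "r (?p X) \<le> r (?p Y)" by (rule mono[OF pin[OF X] pin[OF that(2)]])
    then show ?thesis using rk[OF X] rk[OF that(2)] by simp
  qed
  have subl: "local_rank r a (X \<union> Y) + local_rank r a (X \<inter> Y) \<le> local_rank r a X + local_rank r a Y"
    if "X \<subseteq> ?E" "Y \<subseteq> ?E" for X Y
  proof -
    have "sup (?p X) (?p Y) = ?p (X \<union> Y)" "inf (?p X) (?p Y) = ?p (X \<inter> Y)"
      by (auto simp: fun_eq_iff sup_fun_def inf_fun_def sup_nat_def inf_nat_def)
    moreover have "X \<inter> Y \<subseteq> ?E" "X \<union> Y \<subseteq> ?E" using that by auto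
    ultimately show ?thesis
      using subm[OF pin[OF that(1)] pin[OF that(2)]] rk that by simp
  qed
  have empty: "local_rank r a {} = 0" by (simp add: local_rank_def)
  have single: "local_rank r a {i} \<le> 1" if i: "i \<in> ?E" for i
  proof -
    let ?s = "\<lambda>t j. t * unit_vec i j"
    have pi: "?p {i} \<in> hypercuboid m \<rho>" by (rule pin) (use i in auto)
    have im: "i \<in> {1..m}" using i by (auto simp: local_ground_def)
    then have le: "a i + 1 \<le> \<rho> i" using pi unfolding hypercuboid_def by fastforce
    have s: "?s t \<in> hypercuboid m \<rho>" if "t \<le> a i + 1" for t
      using that le im by (auto simp: hypercuboid_def unit_vec_def)
    have "sup a (?s (a i + 1)) = ?p {i}" "inf a (?s (a i + 1)) = ?s (a i)"
      by (auto simp: fun_eq_iff sup_fun_def inf_fun_def sup_nat_def inf_nat_def unit_vec_def)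
    then have "r (?p {i}) + r (?s (a i)) \<le> r a + r (?s (a i + 1))"
      using subm[OF a s[of "a i + 1"]] by simp
    moreover have "r (?s (a i + 1)) - r (?s (a i + 1 - 1)) \<le> 1"
      using mc im le unfolding matricube_def by (meson atLeastAtMost_iff le_add2)
    ultimately show ?thesis using rk[of "{i}"] i by simp
  qed
  have card: "local_rank r a X \<le> int (card X)" if "X \<subseteq> ?E" for X
  proof -
    have "finite X" using that finE by (rule finite_subset)
    then show ?thesis using that
    proof (induction X rule: finite_induct)
      case empty
      then show ?case by (simp add: \<open>local_rank r a {} = 0\<close>)
    next
      case (insert i X)
      have "local_rank r a (X \<union> {i}) + local_rank r a (X \<inter> {i}) \<le> local_rank r a X + local_rank r a {i}"
        using insert.prems by (intro subl) auto
      then show ?case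
        using insert single[of i] \<open>local_rank r a {} = 0\<close> by simp
    qed
  qed
  have nonneg: "0 \<le> local_rank r a X" if "X \<subseteq> ?E" for X
    using monol[of "{}" X] that empty by simp
  show ?thesis
    unfolding matroid_def by (intro conjI allI impI) (simp_all add: finE card nonneg monol subl)
qed

lemma embed_fin_dim:
  fixes scale :: "'k::field \<Rightarrow> 'v::ab_group_add \<Rightarrow> 'v"
  assumes "vector_space scale" "fin_dim_subspace scale H"
  obtains g :: "'v \<Rightarrow> nat \<Rightarrow> 'k" where "Vector_Spaces.linear scale seq_scale g" "inj_on g H"
proof -
  interpret vs1: vector_space scale by fact
  interpret vs2: vector_space "seq_scale :: 'k \<Rightarrow> (nat \<Rightarrow> 'k) \<Rightarrow> (nat \<Rightarrow> 'k)"
    by (rule vector_space_seq_scale)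
  interpret P: vector_space_pair scale "seq_scale :: 'k \<Rightarrow> (nat \<Rightarrow> 'k) \<Rightarrow> (nat \<Rightarrow> 'k)" ..
  obtain S where S: "finite S" "vs1.span S = H"
    using assms by (auto simp: fin_dim_subspace_def)
  obtain B where B: "B \<subseteq> H" "vs1.independent B" "H \<subseteq> vs1.span B"
    using vs1.maximal_independent_subset by blast
  have finB: "finite B"
    using vs1.independent_span_bound[of S B] S B by auto
  then obtain f :: "'v \<Rightarrow> nat" where f: "inj_on f B"
    using finite_imp_inj_to_nat_seg by blast
  define u where "u b = (\<lambda>n. if n = f b then 1 else 0 :: 'k)" for b
  obtain g where g: "Vector_Spaces.linear scale seq_scale g" "\<forall>b\<in>B. g b = u b"
    using P.linear_independent_extend[OF B(2), of u] by blast
  interpret g: Vector_Spaces.linear scale seq_scale g by (rule g(1))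
  have "v = 0" if v: "v \<in> vs1.span B" and gv: "g v = 0" for v
  proof -
    obtain c where c: "v = (\<Sum>b\<in>B. scale (c b) b)"
      using v finB by (auto simp: vs1.span_finite)
    have "c b = 0" if b: "b \<in> B" for b
    proof -
      have app: "(\<Sum>x\<in>A. h x) n = (\<Sum>x\<in>A. h x n)" for A :: "'v set" and h :: "'v \<Rightarrow> nat \<Rightarrow> 'k" and n
        by (induction A rule: infinite_finite_induct) auto
      have "g v = (\<Sum>b\<in>B. seq_scale (c b) (u b))"
        unfolding c using g(2) by (simp add: g.sum g.scale)
      then have "g v (f b) = (\<Sum>b'\<in>B. seq_scale (c b') (u b') (f b))"
        by (simp add: app)
      also have "\<dots> = (\<Sum>b'\<in>B. if b' = b then c b' else 0)"
        by (rule sum.cong) (use f b in \<open>auto simp: seq_scale_def u_def inj_on_def\<close>)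
      finally show "c b = 0" using gv finB b by simp
    qed
    then show "v = 0" unfolding c by simp
  qed
  then have "inj_on g (vs1.span B)"
    using g.inj_on_iff_eq_0[OF vs1.subspace_span] by blast
  then have "inj_on g H"
    using B(3) by (rule inj_on_subset)
  then show ?thesis using g(1) that by blast
qed

lemma dim_image_inj_on:
  assumes "Vector_Spaces.linear s1 s2 g" and "inj_on g H" "module.subspace s1 H" "W \<subseteq> H"
  shows "vector_space.dim s2 (g ` W) = vector_space.dim s1 W"
proof -
  interpret g: Vector_Spaces.linear s1 s2 g by fact
  obtain B where B: "B \<subseteq> W" "g.vs1.independent B" "W \<subseteq> g.vs1.span B" "card B = g.vs1.dim W"
    using g.vs1.basis_exists by blast
  have "g.vs1.span B \<subseteq> H"
    using B(1) assms(3,4) by (intro g.vs1.span_minimal) auto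
  then have inj: "inj_on g (g.vs1.span B)"
    using assms(2) inj_on_subset by blast
  have ind: "g.vs2.independent (g ` B)"
    using g.independent_injective_image[OF B(2) inj] .
  have "card (g ` B) = card B"
    using inj inj_on_subset[OF inj g.vs1.span_superset] by (simp add: card_image)
  moreover have "g ` W \<subseteq> g.vs2.span (g ` B)"
    using B(3) by (auto simp: g.span_image)
  ultimately show ?thesis
    by (intro g.vs2.dim_unique[OF image_mono[OF B(1)] _ ind]) (simp_all only: B(4))
qed

lemma fin_dim_subspace_image:
  assumes "Vector_Spaces.linear s1 s2 g" "fin_dim_subspace s1 H"
  shows "fin_dim_subspace s2 (g ` H)"
proof -
  interpret g: Vector_Spaces.linear s1 s2 g by fact
  obtain B where "finite B" "g.vs1.span B = H" "g.vs1.subspace H"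
    using assms by (auto simp: fin_dim_subspace_def)
  then show ?thesis
    unfolding fin_dim_subspace_def
    by (metis g.subspace_image g.span_image finite_imageI)
qed

lemma initial_flag_subset:
  assumes "initial_flag scale H s F" "i \<le> s"
  shows "F i \<subseteq> H"
  using assms(2)
proof (induction i)
  case 0
  then show ?case using assms(1) by (simp add: initial_flag_def)
next
  case (Suc i)
  have "Suc i \<in> {1..s}" using Suc.prems by simp
  then have "F (Suc i) \<subseteq> F (Suc i - 1)"
    using assms(1) unfolding initial_flag_def by blast
  then show ?case using Suc by auto
qed

lemma matricube_representableI:
  fixes scale :: "'k::field \<Rightarrow> 'v::ab_group_add \<Rightarrow> 'v"
  assumes "vector_space scale" "m \<ge> 1" and rep: "matricube_representation scale H F m \<rho> r"
  shows "matricube_representable TYPE('k) m \<rho> r"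
proof -
  have fd: "fin_dim_subspace scale H" and sub: "module.subspace scale H"
    and fl: "\<And>j. j \<in> {1..m} \<Longrightarrow> initial_flag scale H (\<rho> j) (F j)"
    and rk: "\<And>x. x \<in> hypercuboid m \<rho> \<Longrightarrow> r x = codim scale H (\<Inter>j\<in>{1..m}. F j (x j))"
    using rep by (auto simp: matricube_representation_def fin_dim_subspace_def)
  obtain g :: "'v \<Rightarrow> nat \<Rightarrow> 'k" where g: "Vector_Spaces.linear scale seq_scale g" and inj: "inj_on g H"
    using embed_fin_dim[OF assms(1) fd] .
  interpret g: Vector_Spaces.linear scale seq_scale g by (rule g)
  have FH: "F j i \<subseteq> H" if "j \<in> {1..m}" "i \<le> \<rho> j" for i j
    using initial_flag_subset[OF fl[OF that(1)] that(2)] .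
  have cod: "codim seq_scale (g ` W) (g ` W') = codim scale W W'" if "W \<subseteq> H" "W' \<subseteq> H" for W W'
    using that by (simp add: codim_def dim_image_inj_on[OF g inj sub])
  have "initial_flag seq_scale (g ` H) (\<rho> j) (\<lambda>i. g ` F j i)" if j: "j \<in> {1..m}" for j
    unfolding initial_flag_def
  proof (intro conjI allI impI ballI)
    show "g ` F j 0 = g ` H" using fl[OF j] by (simp add: initial_flag_def)
    show "g.vs2.subspace (g ` F j i)" if "i \<le> \<rho> j" for i
      using fl[OF j] that by (auto simp: initial_flag_def intro: g.subspace_image)
    show "g ` F j i \<subseteq> g ` F j (i - 1)" if "i \<in> {1..\<rho> j}" for i
      using fl[OF j] that unfolding initial_flag_def by blast
    show "codim seq_scale (g ` F j (i - 1)) (g ` F j i) \<in> {0, 1}" if "i \<in> {1..\<rho> j}" for i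
    proof -
      have "codim scale (F j (i - 1)) (F j i) \<in> {0, 1}"
        using fl[OF j] that unfolding initial_flag_def by blast
      moreover have "i - 1 \<le> \<rho> j" "i \<le> \<rho> j" using that by auto
      then have "F j (i - 1) \<subseteq> H" "F j i \<subseteq> H" by (blast intro!: FH[OF j])+
      ultimately show ?thesis
        by (simp only: cod)
    qed
    have "{0} \<subset> F j (\<rho> j)" using fl[OF j] by (simp add: initial_flag_def)
    then obtain w where w: "w \<in> F j (\<rho> j)" "w \<noteq> 0" and z: "0 \<in> F j (\<rho> j)" by blast
    then have "g w \<noteq> g 0"
      using inj_onD[OF inj, of w 0] FH[OF j order_refl] by blast
    then have "g w \<noteq> 0" by (simp add: g.zero)
    moreover have "0 \<in> g ` F j (\<rho> j)" using z g.zero by (metis imageI)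
    ultimately show "{0} \<subset> g ` F j (\<rho> j)"
      using w(1) by blast
  qed
  moreover have "r x = codim seq_scale (g ` H) (\<Inter>j\<in>{1..m}. g ` F j (x j))"
    if x: "x \<in> hypercuboid m \<rho>" for x
  proof -
    have xF: "F j (x j) \<subseteq> H" if "j \<in> {1..m}" for j
      using x that by (intro FH) (auto simp: hypercuboid_def)
    have "g ` (\<Inter>j\<in>{1..m}. F j (x j)) = (\<Inter>j\<in>{1..m}. g ` F j (x j))"
      using \<open>m \<ge> 1\<close> xF by (intro image_INT[OF inj, of _ _ 1]) auto
    moreover have "(\<Inter>j\<in>{1..m}. F j (x j)) \<subseteq> H"
      using \<open>m \<ge> 1\<close> xF[of 1] by fastforce
    ultimately show ?thesis
      using rk[OF x] cod[of H "\<Inter>j\<in>{1..m}. F j (x j)"] by simp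
  qed
  moreover have "fin_dim_subspace seq_scale (g ` H)"
    using fin_dim_subspace_image[OF g fd] .
  ultimately have "matricube_representation seq_scale (g ` H) (\<lambda>j i. g ` F j i) m \<rho> r"
    by (simp add: matricube_representation_def)
  then show ?thesis
    by (auto simp: matricube_representable_def)
qed

lemma matroid_representableI:
  fixes scale :: "'k::field \<Rightarrow> 'v::ab_group_add \<Rightarrow> 'v"
  assumes "vector_space scale" and rep: "matroid_representation scale V v E rk"
  shows "matroid_representable TYPE('k) E rk"
proof -
  have fd: "fin_dim_subspace scale V" and sub: "module.subspace scale V" and vE: "v ` E \<subseteq> V"
    and rk: "\<And>X. X \<subseteq> E \<Longrightarrow> rk X = int (vector_space.dim scale (module.span scale (v ` X)))"
    using rep by (auto simp: matroid_representation_def fin_dim_subspace_def)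
  obtain g :: "'v \<Rightarrow> nat \<Rightarrow> 'k" where g: "Vector_Spaces.linear scale seq_scale g" and inj: "inj_on g V"
    using embed_fin_dim[OF assms(1) fd] .
  interpret g: Vector_Spaces.linear scale seq_scale g by (rule g)
  have "rk X = int (g.vs2.dim (g.vs2.span ((g \<circ> v) ` X)))" if X: "X \<subseteq> E" for X
  proof -
    have "g.vs1.span (v ` X) \<subseteq> V"
      using X vE sub by (intro g.vs1.span_minimal) auto
    then show ?thesis
      using rk[OF X] dim_image_inj_on[OF g inj sub, of "g.vs1.span (v ` X)"]
      by (simp only: image_comp[symmetric] g.span_image)
  qed
  moreover have "fin_dim_subspace seq_scale (g ` V)"
    using fin_dim_subspace_image[OF g fd] .
  ultimately have "matroid_representation seq_scale (g ` V) (g \<circ> v) E rk"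
    using vE by (auto simp: matroid_representation_def)
  then show ?thesis
    by (auto simp: matroid_representable_def)
qed

end

theory Submission
  imports Defs
begin

text \<open>
  Write \<open>W\<close> for the intersection of the flag members \<open>F j (a j)\<close>.  Raising the \<open>i\<close>-th
  coordinate of \<open>a\<close> by one replaces \<open>F i (a i)\<close> by a subspace of codimension at most one, that
  is, by the kernel of some linear functional on \<open>F i (a i)\<close> (\<open>functional_with_kernel\<close>).
  Restricted to \<open>W\<close>, these functionals cut out, for a set \<open>X\<close> of coordinates, exactly the
  intersection that belongs to \<open>a\<close> raised by one in the directions of \<open>X\<close>.  So the local rank
  of \<open>X\<close> is the codimension in \<open>W\<close> of the common zeros of the functionals indexed by \<open>X\<close>, and by
  duality (\<open>dim_span_functionals\<close>) this is the dimension of their span.  Hence the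
  functionals, as vectors of the dual of \<open>W\<close>, represent the local matroid.
\<close>

section \<open>Growth of dimension\<close>

text \<open>
  The dimension of a space without finite basis is \<open>0\<close> by convention, so the count needs \<open>S\<close>
  to lie in the span of a finite set.
\<close>

lemma (in vector_space) dim_insert_notin_span:
  assumes "finite T" "S \<subseteq> span T" "w \<notin> span S"
  shows "dim (insert w S) = Suc (dim S)"
proof -
  obtain B where B: "B \<subseteq> S" "independent B" "S \<subseteq> span B" "card B = dim S"
    using basis_exists by blast
  have "finite B"
    using independent_span_bound[OF assms(1) B(2)] B(1) assms(2) by blast
  have spB: "span B = span S"
    using B(1,3) by (metis span_eq span_superset subset_trans)
  then have w: "w \<notin> span B" using assms(3) by simp
  then have "w \<notin> B" using span_base by blast
  have "independent (insert w B)"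
    using w B(2) by (rule independent_insertI)
  moreover have "insert w S \<subseteq> span (insert w B)"
    using B(3) span_mono[of B "insert w B"] span_base[of w "insert w B"] by blast
  ultimately have "dim (insert w S) = card (insert w B)"
    using B(1) by (intro dim_unique) auto
  then show ?thesis
    using \<open>finite B\<close> \<open>w \<notin> B\<close> B(4) by simp
qed

section \<open>Linear functionals on a subspace\<close>

text \<open>
  The dual of \<open>W\<close>, realised inside the functions on the ambient space.  Vanishing outside \<open>W\<close>
  makes a functional determined by its values on \<open>W\<close>, so that equality and linear
  dependence of functionals on \<open>W\<close> are those of functions.
\<close>

definition functional_on ::
    "('k::field \<Rightarrow> 'v::ab_group_add \<Rightarrow> 'v) \<Rightarrow> 'v set \<Rightarrow> ('v \<Rightarrow> 'k) \<Rightarrow> bool" where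
  "functional_on scale W f \<longleftrightarrow>
     (\<forall>x\<in>W. \<forall>y\<in>W. f (x + y) = f x + f y) \<and> (\<forall>c. \<forall>x\<in>W. f (scale c x) = c * f x) \<and>
     (\<forall>x. x \<notin> W \<longrightarrow> f x = 0)"

definition fun_scale :: "'k::field \<Rightarrow> ('v \<Rightarrow> 'k) \<Rightarrow> ('v \<Rightarrow> 'k)" where
  "fun_scale c f = (\<lambda>x. c * f x)"

lemma vector_space_fun_scale: "vector_space fun_scale"
  by standard (auto simp: fun_scale_def fun_eq_iff algebra_simps)

lemma functional_on_diff_scale:
  assumes "functional_on scale W f" "functional_on scale W g"
  shows "functional_on scale W (g - fun_scale c f)"
  using assms by (auto simp: functional_on_def fun_scale_def algebra_simps)

lemma functional_on_restrict:
  assumes "functional_on scale F f" "W \<subseteq> F" "module.subspace scale W" "vector_space scale"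
  shows "functional_on scale W (\<lambda>x. if x \<in> W then f x else 0)"
proof -
  interpret vector_space scale by fact
  show ?thesis
    using assms(1-3) by (auto simp: functional_on_def subset_iff intro: subspace_add subspace_scale)
qed

definition common_zeros :: "'v set \<Rightarrow> ('e \<Rightarrow> 'v \<Rightarrow> 'k::zero) \<Rightarrow> 'e set \<Rightarrow> 'v set" where
  "common_zeros W f X = {x \<in> W. \<forall>i\<in>X. f i x = 0}"

lemma common_zeros_insert:
  "common_zeros W f (insert i X) = {x \<in> common_zeros W f X. f i x = 0}"
  by (auto simp: common_zeros_def)

context vector_space
begin

lemma functional_on_diff_scale_arg:
  assumes "functional_on scale W f" "subspace W" "x \<in> W" "y \<in> W"
  shows "f (x - scale c y) = f x - c * f y"
proof -
  have "f (x + scale (- c) y) = f x + (- c) * f y"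
    using assms by (simp add: functional_on_def subspace_scale del: scale_minus_left)
  then show ?thesis by simp
qed

lemma subspace_common_zeros:
  assumes "subspace W" "\<And>i. i \<in> X \<Longrightarrow> functional_on scale W (f i)"
  shows "subspace (common_zeros W f X)"
proof (rule subspaceI)
  have "f i 0 = 0" if "i \<in> X" for i
    using functional_on_diff_scale_arg[OF assms(2)[OF that] assms(1), of 0 0 1]
      subspace_0[OF assms(1)] by simp
  then show "0 \<in> common_zeros W f X"
    using assms(1) by (simp add: common_zeros_def subspace_0)
qed (use assms in \<open>auto simp: common_zeros_def functional_on_def subspace_add subspace_scale\<close>)

text \<open>
  When \<open>F'\<close> is a proper subspace, \<open>F\<close> is the direct sum of \<open>F'\<close> and the line through any
  vector \<open>w\<close> of \<open>F\<close> outside \<open>F'\<close>; the functional reads off the coefficient of \<open>w\<close>.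
\<close>

lemma functional_with_kernel:
  assumes "finite T" "F \<subseteq> span T" "subspace F" "subspace F'" "F' \<subseteq> F"
    and codim: "codim scale F F' \<in> {0, 1}"
  obtains f where "functional_on scale F f" "\<And>x. x \<in> F \<Longrightarrow> f x = 0 \<longleftrightarrow> x \<in> F'"
proof (cases "F' = F")
  case True
  have "functional_on scale F (\<lambda>_. 0)" by (simp add: functional_on_def)
  then show ?thesis using that True by simp
next
  case False
  then obtain w where w: "w \<in> F" "w \<notin> F'" using assms(5) by blast
  have spF': "span F' = F'" using assms(4) by (rule span_eq_iff[THEN iffD2])
  have "w \<notin> span F'" unfolding spF' by (rule w(2))
  then have dim_w: "dim (insert w F') = Suc (dim F')"
    using assms(1,2,5) by (intro dim_insert_notin_span[of T]) auto
  have "F \<subseteq> span (insert w F')"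
  proof (rule ccontr)
    \<comment> \<open>a further vector \<open>z\<close> would make the codimension at least two\<close>
    assume "\<not> F \<subseteq> span (insert w F')"
    then obtain z where z: "z \<in> F" "z \<notin> span (insert w F')" by blast
    let ?S = "insert z (insert w F')"
    have SF: "?S \<subseteq> F" using z w assms(5) by blast
    have "dim ?S = Suc (dim (insert w F'))"
      using SF assms(1,2) z by (intro dim_insert_notin_span[of T]) auto
    moreover have "dim ?S \<le> dim F"
    proof -
      obtain B where B: "B \<subseteq> F" "independent B" "F \<subseteq> span B" "card B = dim F"
        using basis_exists by blast
      have "finite B"
        using independent_span_bound[OF assms(1) B(2)] B(1) assms(2) by blast
      then show ?thesis
        using dim_le_card[of ?S B] SF B(3,4) by auto
    qed
    ultimately show False using dim_w codim by (auto simp: codim_def)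
  qed
  then have ex: "\<exists>c. x - scale c w \<in> F'" if "x \<in> F" for x
    using that span_breakdown_eq[of x w F'] spF' by auto
  have uniq: "c = d" if "x - scale c w \<in> F'" "x - scale d w \<in> F'" for x c d
  proof (rule ccontr)
    assume "c \<noteq> d"
    have "(x - scale c w) - (x - scale d w) \<in> F'"
      using that by (rule subspace_diff[OF assms(4)])
    then have "scale (d - c) w \<in> F'" by (simp add: scale_left_diff_distrib)
    then have "scale (inverse (d - c)) (scale (d - c) w) \<in> F'"
      by (rule subspace_scale[OF assms(4)])
    then show False using \<open>c \<noteq> d\<close> w(2) by simp
  qed
  define f where "f x = (if x \<in> F then THE c. x - scale c w \<in> F' else 0)" for x
  have f_eq: "f x = c" if "x \<in> F" "x - scale c w \<in> F'" for x c
    unfolding f_def using that uniq by (auto intro!: the_equality)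
  have f_mem: "x - scale (f x) w \<in> F'" if "x \<in> F" for x
    using ex[OF that] f_eq[OF that] by blast
  have "functional_on scale F f"
    unfolding functional_on_def
  proof (intro conjI ballI allI impI)
    fix x y assume xy: "x \<in> F" "y \<in> F"
    have "(x - scale (f x) w) + (y - scale (f y) w) \<in> F'"
      using f_mem xy by (intro subspace_add[OF assms(4)])
    then have "(x + y) - scale (f x + f y) w \<in> F'"
      by (simp add: scale_left_distrib algebra_simps)
    then show "f (x + y) = f x + f y"
      using xy assms(3) by (intro f_eq subspace_add)
  next
    fix c x assume x: "x \<in> F"
    have "scale c (x - scale (f x) w) \<in> F'"
      using f_mem x assms(4) by (intro subspace_scale)
    then have "scale c x - scale (c * f x) w \<in> F'"
      by (simp add: scale_right_diff_distrib)
    then show "f (scale c x) = c * f x"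
      using x assms(3) by (intro f_eq subspace_scale)
  qed (simp add: f_def)
  moreover have "f x = 0 \<longleftrightarrow> x \<in> F'" if "x \<in> F" for x
    using f_mem[OF that] f_eq[OF that, of 0] by auto
  ultimately show ?thesis using that by blast
qed

end

section \<open>Duality\<close>

text \<open>
  If \<open>f i\<close> does not vanish at some common zero \<open>w\<close> of the functionals in \<open>X\<close>, then subtracting
  the multiple of \<open>f i\<close> that kills \<open>g w\<close> gives a functional vanishing on all common zeros of
  \<open>X\<close>; this removes \<open>i\<close> from the index set.
\<close>

lemma functional_in_span:
  assumes vs: "vector_space scale" and W: "module.subspace scale W" and "finite X"
    and "\<And>i. i \<in> X \<Longrightarrow> functional_on scale W (f i)" "functional_on scale W g"
    and "\<And>x. x \<in> common_zeros W f X \<Longrightarrow> g x = 0"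
  shows "g \<in> module.span fun_scale (f ` X)"
proof -
  interpret V: vector_space scale by fact
  interpret D: vector_space fun_scale by (rule vector_space_fun_scale)
  show ?thesis using assms(3-6)
  proof (induction X arbitrary: g rule: finite_induct)
    case empty
    then have "g x = 0" for x
      by (cases "x \<in> W") (simp_all add: functional_on_def common_zeros_def)
    then have "g = 0" by (intro ext) simp
    then show ?case by (simp only: D.span_zero)
  next
    case (insert i X)
    let ?K = "common_zeros W f X"
    have fi: "functional_on scale W (f i)" using insert.prems(1) by simp
    have K: "V.subspace ?K"
      using insert.prems(1) by (intro V.subspace_common_zeros[OF W]) simp
    have KW: "?K \<subseteq> W" by (auto simp: common_zeros_def)
    have g0: "g x = 0" if "x \<in> ?K" "f i x = 0" for x
      using insert.prems(3)[of x] that by (simp add: common_zeros_insert)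
    show ?case
    proof (cases "\<exists>w\<in>?K. f i w \<noteq> 0")
      case False
      then have "g \<in> D.span (f ` X)"
        using insert.prems(1,2) g0 by (intro insert.IH) auto
      then show ?thesis using D.span_mono[of "f ` X" "f ` insert i X"] by blast
    next
      case True
      then obtain w where w: "w \<in> ?K" "f i w \<noteq> 0" by blast
      define c where "c = g w / f i w"
      have "(g - fun_scale c (f i)) x = 0" if x: "x \<in> ?K" for x
      proof -
        \<comment> \<open>move \<open>x\<close> along \<open>w\<close> into the kernel of \<open>f i\<close>\<close>
        let ?y = "x - scale (f i x / f i w) w"
        have xw: "x \<in> W" "w \<in> W" using x w KW by blast+
        have "?y \<in> ?K" using x w K by (simp add: V.subspace_diff V.subspace_scale)
        moreover have "f i ?y = 0"
          using w(2) by (simp add: V.functional_on_diff_scale_arg[OF fi W xw])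
        ultimately have "g ?y = 0" by (rule g0)
        then have "g x = f i x / f i w * g w"
          by (simp add: V.functional_on_diff_scale_arg[OF insert.prems(2) W xw])
        then show ?thesis by (simp add: fun_scale_def c_def)
      qed
      then have "g - fun_scale c (f i) \<in> D.span (f ` X)"
        using insert.prems(1,2) fi by (intro insert.IH functional_on_diff_scale) auto
      then show ?thesis using D.span_breakdown_eq[of g "f i" "f ` X"] by auto
    qed
  qed
qed

text \<open>
  The rank of a finite family of functionals is the codimension of its common zeros.  Adding a
  functional outside the span raises the rank by one and, since by
  \<open>functional_in_span\<close> it does not vanish on all current common zeros, lowers their dimension by
  one; adding one inside the span changes neither.
\<close>

lemma dim_span_functionals:
  assumes vs: "vector_space scale" and W: "module.subspace scale W"
    and T: "finite T" "W \<subseteq> module.span scale T" and "finite X"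
    and "\<And>i. i \<in> X \<Longrightarrow> functional_on scale W (f i)"
  shows "int (vector_space.dim fun_scale (module.span fun_scale (f ` X)))
           = codim scale W (common_zeros W f X)"
proof -
  interpret V: vector_space scale by fact
  interpret D: vector_space fun_scale by (rule vector_space_fun_scale)
  have "D.dim (f ` X) + V.dim (common_zeros W f X) = V.dim W"
    using assms(5,6)
  proof (induction X rule: finite_induct)
    case empty
    then show ?case using D.dim_eq_card_independent[OF D.independent_empty] by (simp add: common_zeros_def)
  next
    case (insert i X)
    let ?K = "common_zeros W f X" and ?L = "common_zeros W f (insert i X)"
    have IH: "D.dim (f ` X) + V.dim ?K = V.dim W" using insert by simp
    have fi: "functional_on scale W (f i)" using insert.prems by simp
    have K: "V.subspace ?K" and L: "V.subspace ?L"
      using insert.prems by (auto intro!: V.subspace_common_zeros[OF W])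
    have KW: "?K \<subseteq> W" by (auto simp: common_zeros_def)
    show ?case
    proof (cases "f i \<in> D.span (f ` X)")
      case True
      have dim: "D.dim (f ` insert i X) = D.dim (f ` X)"
        using D.span_redundant[OF True] D.dim_span by (metis image_insert)
      have "f ` X \<subseteq> {h. \<forall>x\<in>?K. h x = 0}" by (auto simp: common_zeros_def)
      moreover have "D.subspace {h. \<forall>x\<in>?K. h x = 0}"
        by (rule D.subspaceI) (auto simp: fun_scale_def)
      ultimately have "f i \<in> {h. \<forall>x\<in>?K. h x = 0}"
        using True D.span_minimal by blast
      then have "?L = ?K" by (auto simp: common_zeros_insert)
      then show ?thesis using IH dim by simp
    next
      case False
      have dim: "D.dim (f ` insert i X) = Suc (D.dim (f ` X))"
        using D.dim_insert_notin_span[of "f ` X" "f ` X"] insert.hyps False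
        by (simp add: D.span_superset)
      have "\<exists>w\<in>?K. f i w \<noteq> 0"
        using functional_in_span[OF vs W insert.hyps(1) _ fi, of f] insert.prems False by auto
      then obtain w where w: "w \<in> ?K" "f i w \<noteq> 0" by blast
      have spL: "V.span ?L = ?L" using L by (rule V.span_eq_iff[THEN iffD2])
      have "x \<in> V.span (insert w ?L)" if x: "x \<in> ?K" for x
      proof -
        let ?c = "f i x / f i w"
        have "x \<in> W" "w \<in> W" using x w KW by blast+
        then have "f i (x - scale ?c w) = 0"
          using w(2) by (simp add: V.functional_on_diff_scale_arg[OF fi W])
        moreover have "x - scale ?c w \<in> ?K"
          using x w K by (simp add: V.subspace_diff V.subspace_scale)
        ultimately have "x - scale ?c w \<in> ?L" by (simp add: common_zeros_insert)
        then show ?thesis using V.span_breakdown_eq[of x w ?L] spL by auto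
      qed
      moreover have "insert w ?L \<subseteq> ?K" using w by (auto simp: common_zeros_insert)
      ultimately have "V.span (insert w ?L) = ?K"
        using V.span_minimal[OF _ K] by blast
      then have "V.dim ?K = V.dim (insert w ?L)" using V.dim_span by metis
      also have "\<dots> = Suc (V.dim ?L)"
      proof (rule V.dim_insert_notin_span[OF T(1)])
        show "?L \<subseteq> V.span T" using T(2) by (auto simp: common_zeros_def)
        show "w \<notin> V.span ?L" unfolding spL using w(2) by (simp add: common_zeros_insert)
      qed
      finally show ?thesis using IH dim by simp
    qed
  qed
  then show ?thesis by (simp add: codim_def)
qed

section \<open>Local matroids\<close>

text \<open>
  The functional for \<open>i\<close> is built on the flag member \<open>F i (a i)\<close> and only then restricted to the
  intersection \<open>W\<close>: on the flag member its kernel is the next member of the flag, so no separate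
  bound on the codimension of \<open>W \<inter> F i (a i + 1)\<close> in \<open>W\<close> has to be derived.
\<close>

lemma matroid_representation_local:
  fixes scale :: "'k::field \<Rightarrow> 'v::ab_group_add \<Rightarrow> 'v"
  assumes vs: "vector_space scale" and "m \<ge> 1"
    and rep: "matricube_representation scale H F m \<rho> r" and a: "a \<in> hypercuboid m \<rho>"
  shows "\<exists>V v. matroid_representation fun_scale V (v :: nat \<Rightarrow> 'v \<Rightarrow> 'k)
           (local_ground m \<rho> a) (local_rank r a)"
proof -
  interpret V: vector_space scale by fact
  interpret D: vector_space fun_scale by (rule vector_space_fun_scale)
  let ?E = "local_ground m \<rho> a"
  define W where "W = (\<Inter>j\<in>{1..m}. F j (a j))"
  obtain T where T: "finite T" "V.span T = H"
    using rep by (auto simp: matricube_representation_def fin_dim_subspace_def)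
  have flag: "initial_flag scale H (\<rho> j) (F j)" if "j \<in> {1..m}" for j
    using rep that by (simp add: matricube_representation_def)
  have rk: "r x = codim scale H (\<Inter>j\<in>{1..m}. F j (x j))" if "x \<in> hypercuboid m \<rho>" for x
    using rep that by (simp add: matricube_representation_def)
  have aj: "a j \<le> \<rho> j" if "j \<in> {1..m}" for j
    using a that unfolding hypercuboid_def by blast
  have F: "V.subspace (F j (a j))" "F j (a j) \<subseteq> H" if "j \<in> {1..m}" for j
    using flag[OF that] initial_flag_subset[OF flag[OF that]] aj[OF that]
    by (auto simp: initial_flag_def)
  have W: "V.subspace W" unfolding W_def using F(1) by (intro V.subspace_Int)
  have "W \<subseteq> H" using F(2)[of 1] \<open>m \<ge> 1\<close> by (force simp: W_def)
  have step: "i \<in> {1..m}" "F i (a i + 1) \<subseteq> F i (a i)"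
    "\<exists>f. functional_on scale (F i (a i)) f \<and> (\<forall>x\<in>F i (a i). f x = 0 \<longleftrightarrow> x \<in> F i (a i + 1))"
    if i: "i \<in> ?E" for i
  proof -
    show im: "i \<in> {1..m}" using i by (simp add: local_ground_def)
    have "a + unit_vec i \<in> hypercuboid m \<rho>" using i by (simp add: local_ground_def)
    then have "(a + unit_vec i) i \<le> \<rho> i" using im unfolding hypercuboid_def by blast
    then have le: "a i + 1 \<le> \<rho> i" by (simp add: unit_vec_def)
    then have "a i + 1 \<in> {1..\<rho> i}" by simp
    then have "F i (a i + 1) \<subseteq> F i (a i + 1 - 1)"
      "codim scale (F i (a i + 1 - 1)) (F i (a i + 1)) \<in> {0, 1}"
      using flag[OF im] unfolding initial_flag_def by blast+
    then have sub: "F i (a i + 1) \<subseteq> F i (a i)"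
      and cod: "codim scale (F i (a i)) (F i (a i + 1)) \<in> {0, 1}" by simp_all
    show "F i (a i + 1) \<subseteq> F i (a i)" by (rule sub)
    have "V.subspace (F i (a i + 1))"
      using flag[OF im] le unfolding initial_flag_def by blast
    then show "\<exists>f. functional_on scale (F i (a i)) f \<and>
        (\<forall>x\<in>F i (a i). f x = 0 \<longleftrightarrow> x \<in> F i (a i + 1))"
      using V.functional_with_kernel[OF T(1) _ F(1)[OF im] _ sub cod] F(2)[OF im] T(2) by metis
  qed
  obtain f where f: "\<And>i. i \<in> ?E \<Longrightarrow> functional_on scale (F i (a i)) (f i)"
    and ker: "\<And>i x. i \<in> ?E \<Longrightarrow> x \<in> F i (a i) \<Longrightarrow> f i x = 0 \<longleftrightarrow> x \<in> F i (a i + 1)"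
    using step(3) by metis
  define v where "v i x = (if x \<in> W then f i x else 0)" for i x
  have WF: "W \<subseteq> F j (a j)" if "j \<in> {1..m}" for j using that by (auto simp: W_def)
  have v: "functional_on scale W (v i)" if "i \<in> ?E" for i
    using functional_on_restrict[OF f[OF that] WF[OF step(1)[OF that]] W vs]
    by (simp add: v_def[abs_def])
  have finE: "finite ?E" by (simp add: local_ground_def)
  have "local_rank r a X = int (D.dim (D.span (v ` X)))" if X: "X \<subseteq> ?E" for X
  proof -
    let ?x = "\<lambda>j. if j \<in> X then a j + 1 else a j"
    have "(\<Inter>j\<in>{1..m}. F j (?x j)) = common_zeros W v X"
    proof (intro equalityI subsetI)
      fix x assume x: "x \<in> (\<Inter>j\<in>{1..m}. F j (?x j))"
      then have xj: "x \<in> F j (?x j)" if "j \<in> {1..m}" for j using that by blast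
      have "x \<in> F j (a j)" if "j \<in> {1..m}" for j
      proof (cases "j \<in> X")
        case True
        then show ?thesis using xj[OF that] step(2)[of j] X by auto
      qed (use xj[OF that] in simp)
      then have "x \<in> W" by (simp add: W_def)
      moreover have "v i x = 0" if i: "i \<in> X" for i
      proof -
        have "i \<in> ?E" using i X by blast
        then show ?thesis
          using xj[of i] i \<open>x \<in> W\<close> ker[of i x] step(1)[of i] WF[of i] by (auto simp: v_def)
      qed
      ultimately show "x \<in> common_zeros W v X" by (simp add: common_zeros_def)
    next
      fix x assume x: "x \<in> common_zeros W v X"
      then have xW: "x \<in> W" by (simp add: common_zeros_def)
      have "x \<in> F j (?x j)" if j: "j \<in> {1..m}" for j
      proof (cases "j \<in> X")
        case True
        then have "f j x = 0" using x xW by (auto simp: common_zeros_def v_def)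
        then show ?thesis using True X ker[of j x] WF[OF j] xW by auto
      qed (use WF[OF j] xW in auto)
      then show "x \<in> (\<Inter>j\<in>{1..m}. F j (?x j))" by blast
    qed
    then have "local_rank r a X = codim scale H (common_zeros W v X) - codim scale H W"
      using local_rank_vec[OF a X] rk[of ?x] rk[OF a] by (simp add: local_rank_def W_def)
    also have "\<dots> = codim scale W (common_zeros W v X)" by (simp add: codim_def)
    also have "\<dots> = int (D.dim (D.span (v ` X)))"
      using X v finE T \<open>W \<subseteq> H\<close>
      by (intro dim_span_functionals[OF vs W T(1), symmetric]) (auto intro: finite_subset)
    finally show ?thesis .
  qed
  moreover have "fin_dim_subspace fun_scale (D.span (v ` ?E))"
    using finE by (auto simp: fin_dim_subspace_def)
  ultimately have "matroid_representation fun_scale (D.span (v ` ?E)) v ?E (local_rank r a)"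
    by (simp add: matroid_representation_def D.span_superset)
  then show ?thesis by blast
qed

theorem proposition8p2:
  fixes m :: nat and \<rho> :: "nat \<Rightarrow> nat" and r :: "(nat \<Rightarrow> nat) \<Rightarrow> int"
  assumes "m \<ge> 1"
    and "matricube m \<rho> r"
    and "matricube_representable TYPE('k::field) m \<rho> r"
  shows "\<forall>a \<in> hypercuboid m \<rho>.
           matroid_representable TYPE('k) (local_ground m \<rho> a) (local_rank r a)"
proof
  fix a assume a: "a \<in> hypercuboid m \<rho>"
  obtain H F where "matricube_representation (seq_scale :: 'k \<Rightarrow> _) H F m \<rho> r"
    using assms(3) by (auto simp: matricube_representable_def)
  then obtain V and v :: "nat \<Rightarrow> (nat \<Rightarrow> 'k) \<Rightarrow> 'k" where
    "matroid_representation fun_scale V v (local_ground m \<rho> a) (local_rank r a)"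
    using matroid_representation_local[OF vector_space_seq_scale assms(1) _ a] by blast
  then show "matroid_representable TYPE('k) (local_ground m \<rho> a) (local_rank r a)"
    by (rule matroid_representableI[OF vector_space_fun_scale])
qed

end
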